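(* Let $n,m\ge 1$ and let $F:\mathbb{R}_{+}^{n}\rightrightarrows \mathbb{R}_{+}^{m}$ be a set-valued mapping. Then $F$ is ICR (increasing and co-radiant), upper semicontinuous and takes only nonempty compact normal values if, and only if, there exists a nonempty set $T\subset (\mathbb{R}_{+}^{m}\setminus\{0\})\times\mathbb{R}_{+}^{n}\times\mathbb{R}_{+}$ such that $$F=\bigcap_{(\ell,k,c)\in T}\Delta_{\ell,k,c},$$ where the intersection is pointwise, i.e. $F(x)=\bigcap_{(\ell,k,c)\in T}\Delta_{\ell,k,c}(x)$ for every $x\in\mathbb{R}_+^n$.
   Context: $\mathbb{R}_{+}^{n}$ is the nonnegative orthant of $\mathbb{R}^n$; $x\le y$ is the componentwise order. A set-valued mapping $F:\mathbb{R}_{+}^{n}\rightrightarrows \mathbb{R}_{+}^{m}$ assigns to each $x\in\mathbb{R}_+^n$ a subset $F(x)\subset\mathbb{R}_+^m$; $gr(F)=\{(x,y): y\in F(x)\}$. $F$ is increasing if $x\le y$ implies $F(x)\subset F(y)$. $F$ is co-radiant if its graph is nonempty and $F(tx)\supset tF(x)$ for all $x\in\mathbb{R}_+^n$, $t\in(0,1]$. ICR means increasing and co-radiant. A set $C\subset\mathbb{R}_+^m$ is normal if $x\in C$, $0\le y\le x$ imply $y\in C$. $F$ (with nonempty values) is upper semicontinuous if for every $x\in\mathbb{R}_+^n$ and every open set $V$ in $\mathbb{R}_+^m$ (relative topology) with $F(x)\subset V$ there is an open neighborhood $U$ of $x$ in $\mathbb{R}_+^n$ such that $F(x')\subset V$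 for all $x'\in U$. For $\ell\in\mathbb{R}_+^m\setminus\{0\}$ and $y\in\mathbb{R}_+^m$, $\langle\ell,y\rangle:=\min\{\ell_iy_i: i\in\{1,\dots,m\},\ \ell_i>0\}$ (this is not the usual inner product). For $k\in\mathbb{R}_+^n$, $c\in\mathbb{R}_+$ and $x\in\mathbb{R}_+^n$, $h_{k,c}^{+}(x):=\max\{\max_{1\le i\le n}k_ix_i,\ c\}$. For $\ell\in\mathbb{R}_+^m\setminus\{0\}$, $k\in\mathbb{R}_+^n$, $c\in\mathbb{R}_+$, the mapping $\Delta_{\ell,k,c}:\mathbb{R}_+^n\rightrightarrows\mathbb{R}_+^m$ is $$\Delta_{\ell,k,c}(x):=\left\{y\in\mathbb{R}_+^m:\ \max\left\{\max_{1\le i\le m}y_i,\ \langle\ell,y\rangle\right\}\le h_{k,c}^{+}(x)\right\}.$$ *)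

theory Defs
  imports "HOL-Analysis.Analysis"
begin

text \<open>
  The order on \<^typ>\<open>real^'n\<close> is the componentwise one. A set-valued mapping from the nonnegative
  orthant of \<open>real^'n\<close> to that of \<open>real^'m\<close> is a function \<open>F :: real^'n \<Rightarrow> (real^'m) set\<close> of which
  only the restriction to \<open>orthant\<close> matters; values at other arguments are never inspected.
\<close>

definition orthant :: "(real^'n) set" where
  "orthant = {x. 0 \<le> x}"

definition setvalued_map :: "(real^'n \<Rightarrow> (real^'m) set) \<Rightarrow> bool" where
  "setvalued_map F \<longleftrightarrow> (\<forall>x\<in>orthant. F x \<subseteq> orthant)"

definition graph_of :: "(real^'n \<Rightarrow> (real^'m) set) \<Rightarrow> ((real^'n) \<times> (real^'m)) set" where
  "graph_of F = {(x, y). x \<in> orthant \<and> y \<in> F x}"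

definition increasing_map :: "(real^'n \<Rightarrow> (real^'m) set) \<Rightarrow> bool" where
  "increasing_map F \<longleftrightarrow> (\<forall>x\<in>orthant. \<forall>y\<in>orthant. x \<le> y \<longrightarrow> F x \<subseteq> F y)"

definition coradiant_map :: "(real^'n \<Rightarrow> (real^'m) set) \<Rightarrow> bool" where
  "coradiant_map F \<longleftrightarrow> graph_of F \<noteq> {} \<and>
     (\<forall>x\<in>orthant. \<forall>t\<in>{0<..1}. (\<lambda>y. t *\<^sub>R y) ` F x \<subseteq> F (t *\<^sub>R x))"

definition ICR :: "(real^'n \<Rightarrow> (real^'m) set) \<Rightarrow> bool" where
  "ICR F \<longleftrightarrow> increasing_map F \<and> coradiant_map F"

definition normal_set :: "(real^'m) set \<Rightarrow> bool" where
  "normal_set C \<longleftrightarrow> (\<forall>x\<in>C. \<forall>y. 0 \<le> y \<and> y \<le> x \<longrightarrow> y \<in> C)"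

definition usc_map :: "(real^'n \<Rightarrow> (real^'m) set) \<Rightarrow> bool" where
  "usc_map F \<longleftrightarrow>
     (\<forall>x\<in>orthant. \<forall>V. openin (top_of_set orthant) V \<and> F x \<subseteq> V \<longrightarrow>
        (\<exists>U. openin (top_of_set orthant) U \<and> x \<in> U \<and> (\<forall>x'\<in>U. F x' \<subseteq> V)))"

text \<open>Not an inner product; meaningful only if some component of \<open>l\<close> is positive.\<close>

definition min_pairing :: "real^'m \<Rightarrow> real^'m \<Rightarrow> real" where
  "min_pairing l y = Min {l $ i * y $ i | i. l $ i > 0}"

definition h_plus :: "real^'n \<Rightarrow> real \<Rightarrow> real^'n \<Rightarrow> real" where
  "h_plus k c x = max (Max (range (\<lambda>i. k $ i * x $ i))) c"

definition Delta :: "real^'m \<Rightarrow> real^'n \<Rightarrow> real \<Rightarrow> real^'n \<Rightarrow> (real^'m) set" where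
  "Delta l k c x =
     {y \<in> orthant. max (Max (range (\<lambda>i. y $ i))) (min_pairing l y) \<le> h_plus k c x}"

end

theory Submission imports Defs begin

text \<open>
  Each map \<open>Delta l k c\<close> has a closed graph and is locally bounded, because its values are cut out
  by continuous inequalities and the bound \<open>h_plus k c\<close> on the coordinates is finite near every
  point. Both properties pass to intersections of nonempty families, and for maps into a
  finite-dimensional space they give upper semicontinuity and compact values. Monotonicity,
  co-radiance and normality come from \<open>h_plus k c\<close> being increasing with
  \<open>t * h_plus k c x \<le> h_plus k c (t *\<^sub>R x)\<close> for \<open>t \<le> 1\<close>, and from \<open>min_pairing l\<close> being increasing
  and positively homogeneous.

  Conversely, \<open>F\<close> is the intersection of all \<open>Delta l k c\<close> that contain it, once every point \<open>y0\<close>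
  outside \<open>F x0\<close> is excluded by one of them (lemma \<open>separation\<close>). The idea is that an increasing
  co-radiant map is controlled globally by a single value \<open>F z\<close> at a point \<open>z\<close> of the open orthant:
  every \<open>x\<close> lies below a multiple \<open>t *\<^sub>R z\<close> with \<open>t \<ge> 1\<close>, and then \<open>F x\<close> is contained in the dilation
  of \<open>F z\<close> by \<open>t\<close>. The least such \<open>t\<close> is \<open>h_plus k c x / c\<close> when \<open>k\<close> has the coordinates
  \<open>c / z $ i\<close>, so \<open>F\<close> is contained in \<open>Delta l k c\<close> everywhere as soon as it is at \<open>z\<close>
  (lemma \<open>subset_Delta_if_subset_at_point\<close>). To choose \<open>z\<close>, note that closedness leaves some
  \<open>s *\<^sub>R y0\<close> with \<open>s < 1\<close> outside \<open>F x0\<close>, so by normality \<open>F x0\<close> avoids the closed set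
  \<open>{y. s *\<^sub>R y0 \<le> y}\<close>; by upper semicontinuity \<open>F z\<close> still avoids it for a point \<open>z \<ge> x0\<close> with
  positive coordinates. Avoiding that set is an upper bound on a suitable \<open>min_pairing l\<close>, and the
  factor \<open>s < 1\<close> makes the bound fail at \<open>y0\<close>.
\<close>

section \<open>The pairing and the functions h\<close>

lemma mem_orthant_iff: "x \<in> orthant \<longleftrightarrow> (\<forall>i. 0 \<le> x $ i)"
  by (simp add: orthant_def less_eq_vec_def)

lemma closed_orthant: "closed (orthant :: (real^'n) set)"
proof -
  have "orthant = (\<Inter>i. {x :: real^'n. 0 \<le> x $ i})"
    by (auto simp: mem_orthant_iff)
  moreover have "closed \<dots>"
    by (intro closed_INT closed_Collect_le continuous_intros ballI)
  ultimately show ?thesis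
    by simp
qed

lemma exists_positive_coordinate:
  assumes "l \<in> orthant - {0}"
  shows "\<exists>i. 0 < l $ i"
  using assms by (auto simp: mem_orthant_iff vec_eq_iff order_less_le)

lemma min_pairing_le_iff:
  assumes "l \<in> orthant - {0}"
  shows "min_pairing l y \<le> a \<longleftrightarrow> (\<exists>i. 0 < l $ i \<and> l $ i * y $ i \<le> a)"
proof -
  have eq: "{l $ i * y $ i | i. l $ i > 0} = (\<lambda>i. l $ i * y $ i) ` {i. l $ i > 0}"
    by auto
  show ?thesis
    unfolding min_pairing_def eq
    using exists_positive_coordinate[OF assms] by (subst Min_le_iff) auto
qed

lemma h_plus_le_iff: "h_plus k c x \<le> a \<longleftrightarrow> c \<le> a \<and> (\<forall>i. k $ i * x $ i \<le> a)"
  unfolding h_plus_def by (auto simp: Max_le_iff)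

lemma h_plus_less_iff: "h_plus k c x < a \<longleftrightarrow> c < a \<and> (\<forall>i. k $ i * x $ i < a)"
  unfolding h_plus_def by (auto simp: Max_less_iff)

lemma le_h_plus_iff: "a \<le> h_plus k c x \<longleftrightarrow> a \<le> c \<or> (\<exists>i. a \<le> k $ i * x $ i)"
  using h_plus_less_iff[of k c x a] by (meson not_le)

lemma mem_Delta_iff:
  assumes "l \<in> orthant - {0}"
  shows "y \<in> Delta l k c x \<longleftrightarrow>
    y \<in> orthant \<and> (\<forall>i. y $ i \<le> h_plus k c x) \<and> (\<exists>i. 0 < l $ i \<and> l $ i * y $ i \<le> h_plus k c x)"
  unfolding Delta_def using min_pairing_le_iff[OF assms] by (auto simp: Max_le_iff)

section \<open>Intersections of the maps Delta\<close>

lemma h_plus_mono: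
  assumes "k \<in> orthant" "x \<le> y"
  shows "h_plus k c x \<le> h_plus k c y"
proof -
  have "k $ i * x $ i \<le> k $ i * y $ i" for i
    using assms by (intro mult_left_mono) (auto simp: mem_orthant_iff less_eq_vec_def)
  moreover have "c \<le> h_plus k c y" "\<And>i. k $ i * y $ i \<le> h_plus k c y"
    by (auto simp: le_h_plus_iff)
  ultimately show ?thesis
    by (auto simp: h_plus_le_iff intro: order_trans)
qed

lemma h_plus_nonneg: "0 \<le> c \<Longrightarrow> 0 \<le> h_plus k c x"
  by (simp add: le_h_plus_iff)

lemma scale_h_plus_le:
  assumes "0 \<le> c" "0 < t" "t \<le> 1"
  shows "t * h_plus k c x \<le> h_plus k c (t *\<^sub>R x)"
proof -
  have "t * c \<le> h_plus k c (t *\<^sub>R x)"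
    using mult_right_mono[OF \<open>t \<le> 1\<close> \<open>0 \<le> c\<close>] by (simp add: le_h_plus_iff)
  moreover have "t * (k $ i * x $ i) \<le> h_plus k c (t *\<^sub>R x)" for i
    unfolding le_h_plus_iff by (intro disjI2 exI[of _ i]) (simp add: mult_ac)
  ultimately have "h_plus k c x \<le> h_plus k c (t *\<^sub>R x) / t"
    using \<open>0 < t\<close> by (auto simp: h_plus_le_iff field_simps)
  then show ?thesis
    using \<open>0 < t\<close> by (simp add: field_simps)
qed

lemma Delta_increasing:
  assumes "l \<in> orthant - {0}" "k \<in> orthant" "x \<le> x'"
  shows "Delta l k c x \<subseteq> Delta l k c x'"
  unfolding Delta_def by (intro Collect_mono impI) (meson h_plus_mono[OF assms(2,3)] order_trans)

lemma scale_mem_Delta: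
  assumes l: "l \<in> orthant - {0}" and "0 \<le> c" "0 < t" "t \<le> 1" and y: "y \<in> Delta l k c x"
  shows "t *\<^sub>R y \<in> Delta l k c (t *\<^sub>R x)"
proof -
  have *: "t * a \<le> h_plus k c (t *\<^sub>R x)" if "a \<le> h_plus k c x" for a
    using scale_h_plus_le[of c t k x] mult_left_mono[OF that, of t] assms(2-4) by linarith
  from y obtain i where "0 < l $ i" "l $ i * y $ i \<le> h_plus k c x"
    by (auto simp: mem_Delta_iff[OF l])
  then have "0 < l $ i \<and> l $ i * (t *\<^sub>R y) $ i \<le> h_plus k c (t *\<^sub>R x)"
    using *[of "l $ i * y $ i"] by (simp add: mult_ac)
  with y * \<open>0 < t\<close> show ?thesis
    by (auto simp: mem_Delta_iff[OF l] mem_orthant_iff)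
qed

lemma Delta_normal:
  assumes l: "l \<in> orthant - {0}" and y: "y \<in> Delta l k c x" and "0 \<le> y'" "y' \<le> y"
  shows "y' \<in> Delta l k c x"
proof -
  have le: "y' $ i \<le> y $ i" for i
    using \<open>y' \<le> y\<close> by (simp add: less_eq_vec_def)
  moreover have "l $ i * y' $ i \<le> l $ i * y $ i" for i
    using l le by (intro mult_left_mono) (auto simp: mem_orthant_iff)
  ultimately show ?thesis
    using y \<open>0 \<le> y'\<close> unfolding mem_Delta_iff[OF l] by (auto simp: orthant_def intro: order_trans)
qed

lemma zero_mem_Delta:
  assumes "l \<in> orthant - {0}" "0 \<le> c"
  shows "0 \<in> Delta l k c x"
  using exists_positive_coordinate[OF assms(1)] h_plus_nonneg[OF assms(2)]
  by (auto simp: mem_Delta_iff[OF assms(1)] mem_orthant_iff)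

text \<open>Membership in \<open>Delta\<close> is a finite combination of non-strict inequalities between affine
  functions of \<open>(x, y)\<close>, since both the maximum and the minimum run over finitely many indices.\<close>

lemma closed_graph_Delta:
  fixes l :: "real^'m" and k :: "real^'n"
  assumes l: "l \<in> orthant - {0}"
  shows "closed {(x, y). y \<in> Delta l k c x}"
proof -
  have le: "closed {p :: (real^'n) \<times> (real^'m). a * snd p $ i \<le> h_plus k c (fst p)}" for a i
  proof -
    have "{p :: (real^'n) \<times> (real^'m). a * snd p $ i \<le> h_plus k c (fst p)} =
        {p. a * snd p $ i \<le> c} \<union> (\<Union>j. {p. a * snd p $ i \<le> k $ j * fst p $ j})"
      by (auto simp: le_h_plus_iff)
    moreover have "closed \<dots>"
      by (intro closed_Un closed_UN closed_Collect_le continuous_intros ballI) auto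
    ultimately show ?thesis
      by simp
  qed
  have "{(x, y). y \<in> Delta l k c x} =
      (UNIV \<times> orthant) \<inter> (\<Inter>i. {p. 1 * snd p $ i \<le> h_plus k c (fst p)}) \<inter>
      (\<Union>i \<in> {i. 0 < l $ i}. {p. l $ i * snd p $ i \<le> h_plus k c (fst p)})"
    by (auto simp: mem_Delta_iff[OF l])
  also have "closed \<dots>"
    by (intro closed_Int closed_INT closed_UN closed_Times closed_UNIV closed_orthant ballI le) auto
  finally show ?thesis .
qed

lemma Delta_subset_box: "Delta l k c x \<subseteq> {y. \<forall>i. 0 \<le> y $ i \<and> y $ i \<le> h_plus k c x}"
  by (auto simp: Delta_def mem_orthant_iff)

lemma compact_box: "compact {y :: real^'m. \<forall>i. 0 \<le> y $ i \<and> y $ i \<le> a}"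
proof -
  have "{y :: real^'m. \<forall>i. 0 \<le> y $ i \<and> y $ i \<le> a} = cbox 0 (\<chi> i. a)"
    by (auto simp: mem_box_cart)
  then show ?thesis
    by simp
qed

text \<open>Compactness of the bounding set makes projection along the values a closed map, so the points
  whose value leaves an open set form a closed set.\<close>

lemma usc_map_if_closed_graph_locally_bounded:
  fixes F :: "real^'n \<Rightarrow> (real^'m) set"
  assumes sv: "setvalued_map F"
    and graph: "closed G" "\<And>x. x \<in> orthant \<Longrightarrow> F x = {y. (x, y) \<in> G}"
    and loc: "\<And>x. x \<in> orthant \<Longrightarrow>
      \<exists>W K. open W \<and> x \<in> W \<and> compact K \<and> (\<forall>x'\<in>W \<inter> orthant. F x' \<subseteq> K)"
  shows "usc_map F"
  unfolding usc_map_def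
proof (intro ballI allI impI)
  fix x :: "real^'n" and V :: "(real^'m) set"
  assume x: "x \<in> orthant" and V: "openin (top_of_set orthant) V \<and> F x \<subseteq> V"
  from V obtain V' where V': "open V'" "V = orthant \<inter> V'"
    by (auto simp: openin_open)
  from loc[OF x] obtain W K where W: "open W" "x \<in> W"
    and K: "compact K" "\<And>x'. x' \<in> W \<Longrightarrow> x' \<in> orthant \<Longrightarrow> F x' \<subseteq> K"
    by blast
  define P where "P = {x'. \<exists>y. y \<in> K - V' \<and> (x', y) \<in> G}"
  have "compact (K - V')"
    using K(1) V'(1) by (rule compact_diff)
  moreover have "closed (prod.swap -` G)"
    using graph(1) by (intro closed_vimage) (auto intro: continuous_on_swap)
  ultimately have "closed {x'. \<exists>y. y \<in> K - V' \<and> (y, x') \<in> prod.swap -` G}"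
    by (rule closed_compact_projection)
  then have "closed P"
    by (simp add: P_def)
  have "x \<notin> P"
    using V V' graph(2)[OF x] by (auto simp: P_def)
  moreover have "F x' \<subseteq> V" if "x' \<in> orthant" "x' \<in> W" "x' \<notin> P" for x'
    using that K(2)[of x'] graph(2)[of x'] sv V'(2) by (fastforce simp: P_def setvalued_map_def)
  ultimately show "\<exists>U. openin (top_of_set orthant) U \<and> x \<in> U \<and> (\<forall>x'\<in>U. F x' \<subseteq> V)"
    using W x \<open>closed P\<close>
    by (intro exI[of _ "orthant \<inter> (W - P)"]) (auto intro!: openin_open_Int open_Diff)
qed

lemma Inter_Delta_properties:
  fixes F :: "real^'n \<Rightarrow> (real^'m) set"
  assumes sv: "setvalued_map F"
    and "T \<noteq> {}" and T: "T \<subseteq> (orthant - {0}) \<times> orthant \<times> {0..}"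
    and F: "\<And>x. x \<in> orthant \<Longrightarrow> F x = (\<Inter>(l, k, c)\<in>T. Delta l k c x)"
  shows "ICR F \<and> usc_map F \<and> (\<forall>x\<in>orthant. F x \<noteq> {} \<and> compact (F x) \<and> normal_set (F x))"
proof -
  have mem: "y \<in> F x \<longleftrightarrow> (\<forall>l k c. (l, k, c) \<in> T \<longrightarrow> y \<in> Delta l k c x)" if "x \<in> orthant" for x y
    using F[OF that] by auto
  have par: "l \<in> orthant - {0}" "k \<in> orthant" "0 \<le> c" if "(l, k, c) \<in> T" for l k c
    using T that by auto
  have zero: "0 \<in> F x" if "x \<in> orthant" for x
    using par by (auto simp: mem[OF that] intro!: zero_mem_Delta)
  define G where "G = (\<Inter>(l, k, c)\<in>T. {(x, y). y \<in> Delta l k c x})"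
  have G: "F x = {y. (x, y) \<in> G}" if "x \<in> orthant" for x
    using mem[OF that] by (auto simp: G_def)
  have "closed G"
    unfolding G_def using par by (auto intro!: closed_INT closed_graph_Delta)
  from \<open>T \<noteq> {}\<close> obtain l0 k0 c0 where T0: "(l0, k0, c0) \<in> T"
    by auto
  have clo: "closed (F x)" if "x \<in> orthant" for x
  proof -
    have "F x = Pair x -` G"
      using G[OF that] by auto
    then show ?thesis
      using \<open>closed G\<close> by (simp add: closed_vimage continuous_on_Pair)
  qed
  have sub: "F x \<subseteq> {y. \<forall>i. 0 \<le> y $ i \<and> y $ i \<le> h_plus k0 c0 x}" if "x \<in> orthant" for x
    using mem[OF that] T0 Delta_subset_box by fast
  have comp: "compact (F x)" if "x \<in> orthant" for x
    using closed_Int_compact[OF clo[OF that] compact_box[of "h_plus k0 c0 x"]] sub[OF that]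
    by (simp only: Int_absorb2)
  have norm: "normal_set (F x)" if "x \<in> orthant" for x
    unfolding normal_set_def
  proof (intro ballI allI impI)
    fix y y'
    assume "y \<in> F x" "0 \<le> y' \<and> y' \<le> y"
    then show "y' \<in> F x"
      using Delta_normal[OF par(1)] unfolding mem[OF that] by blast
  qed
  have inc: "increasing_map F"
    unfolding increasing_map_def
  proof (intro ballI impI subsetI)
    fix x x' y
    assume x: "x \<in> orthant" "x' \<in> orthant" and "x \<le> x'" "y \<in> F x"
    then show "y \<in> F x'"
      using Delta_increasing[OF par(1,2)] unfolding mem[OF x(1)] mem[OF x(2)] by blast
  qed
  have "(0, 0) \<in> graph_of F"
    using zero[of 0] by (auto simp: graph_of_def mem_orthant_iff)
  moreover have "t *\<^sub>R y \<in> F (t *\<^sub>R x)"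
    if "x \<in> orthant" "t \<in> {0<..1}" "y \<in> F x" for x y and t :: real
  proof -
    have tx: "t *\<^sub>R x \<in> orthant" and t: "0 < t" "t \<le> 1"
      using that by (auto simp: mem_orthant_iff)
    show ?thesis
      using that(3) scale_mem_Delta[OF par(1,3) t] unfolding mem[OF that(1)] mem[OF tx] by blast
  qed
  ultimately have cor: "coradiant_map F"
    unfolding coradiant_map_def by blast
  have "usc_map F"
  proof (rule usc_map_if_closed_graph_locally_bounded[OF sv \<open>closed G\<close> G])
    fix x :: "real^'n"
    assume "x \<in> orthant"
    define a where "a = h_plus k0 c0 x + 1"
    define W where "W = {x'. h_plus k0 c0 x' < a}"
    have "W = {x'. c0 < a} \<inter> (\<Inter>i. {x'. k0 $ i * x' $ i < a})"
      by (auto simp: W_def h_plus_less_iff)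
    moreover have "open \<dots>"
      by (intro open_Int open_INT open_Collect_less continuous_intros ballI) auto
    ultimately have "open W"
      by simp
    moreover have "x \<in> W"
      by (simp add: W_def a_def)
    moreover have "\<forall>x'\<in>W \<inter> orthant. F x' \<subseteq> {y. \<forall>i. 0 \<le> y $ i \<and> y $ i \<le> a}"
    proof (intro ballI subsetI CollectI allI)
      fix x' y i
      assume "x' \<in> W \<inter> orthant" "y \<in> F x'"
      then have "h_plus k0 c0 x' < a" "0 \<le> y $ i \<and> y $ i \<le> h_plus k0 c0 x'"
        using sub[of x'] by (auto simp: W_def)
      then show "0 \<le> y $ i \<and> y $ i \<le> a"
        by linarith
    qed
    ultimately show "\<exists>W K. open W \<and> x \<in> W \<and> compact K \<and> (\<forall>x'\<in>W \<inter> orthant. F x' \<subseteq> K)"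
      using compact_box by blast
  qed
  with inc cor zero comp norm show ?thesis
    by (auto simp: ICR_def)
qed

section \<open>Separation of points from the values of F\<close>

lemma h_plus_reciprocal_eq:
  assumes "0 < c" "\<And>i. 0 < z $ i" "x \<le> z"
  shows "h_plus (\<chi> i. c / z $ i) c x = c"
proof (rule antisym)
  have "x $ i \<le> z $ i" for i
    using assms(3) by (simp add: less_eq_vec_def)
  then have "c / z $ i * x $ i \<le> c" for i
    using assms(1,2) mult_left_mono[of "x $ i" "z $ i" c] by (simp add: field_simps)
  then show "h_plus (\<chi> i. c / z $ i) c x \<le> c"
    by (simp add: h_plus_le_iff)
qed (simp add: le_h_plus_iff)

text \<open>With \<open>t = h_plus k c x / c \<ge> 1\<close> one has \<open>x \<le> t *\<^sub>R z\<close>; monotonicity and co-radiance then put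
  \<open>F x\<close> inside the dilation of \<open>F z\<close> by \<open>t\<close>, and \<open>t\<close> also scales the bound \<open>c\<close> at \<open>z\<close> to the bound
  \<open>h_plus k c x\<close> at \<open>x\<close>.\<close>

lemma subset_Delta_if_subset_at_point:
  fixes F :: "real^'n \<Rightarrow> (real^'m) set"
  assumes sv: "setvalued_map F" and icr: "ICR F"
    and c: "0 < c" and z: "\<And>i. 0 < z $ i" and l: "l \<in> orthant - {0}"
    and Fz: "F z \<subseteq> Delta l (\<chi> i. c / z $ i) c z" and x: "x \<in> orthant"
  shows "F x \<subseteq> Delta l (\<chi> i. c / z $ i) c x"
proof
  fix y
  assume y: "y \<in> F x"
  let ?h = "h_plus (\<chi> i. c / z $ i) c"
  define t where "t = ?h x / c"
  have "c \<le> ?h x"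
    by (simp add: le_h_plus_iff)
  then have t: "1 \<le> t" and tc: "?h x = t * c"
    using c by (simp_all add: t_def)
  have tz: "t *\<^sub>R z \<in> orthant"
    using t z by (auto simp: mem_orthant_iff less_imp_le)
  have "x $ i \<le> t * z $ i" for i
  proof -
    have "c / z $ i * x $ i \<le> t * c"
      unfolding tc[symmetric] le_h_plus_iff by (intro disjI2 exI[of _ i]) simp
    then have "c * x $ i \<le> c * (t * z $ i)"
      using z[of i] by (simp add: field_simps)
    then show ?thesis
      using c by simp
  qed
  then have "x \<le> t *\<^sub>R z"
    by (simp add: less_eq_vec_def)
  then have "y \<in> F (t *\<^sub>R z)"
    using icr x y tz by (auto simp: ICR_def increasing_map_def)
  then have "(1 / t) *\<^sub>R y \<in> F ((1 / t) *\<^sub>R (t *\<^sub>R z))"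
    using icr tz t unfolding ICR_def coradiant_map_def by fastforce
  then have "(1 / t) *\<^sub>R y \<in> Delta l (\<chi> i. c / z $ i) c z"
    using t Fz by auto
  then obtain j where "\<And>i. y $ i / t \<le> c" "0 < l $ j" "l $ j * (y $ j / t) \<le> c"
    by (auto simp: mem_Delta_iff[OF l] h_plus_reciprocal_eq[OF c z])
  then show "y \<in> Delta l (\<chi> i. c / z $ i) c x"
    using y x sv t unfolding mem_Delta_iff[OF l] tc
    by (auto simp: setvalued_map_def field_simps intro!: exI[of _ j])
qed

text \<open>The shift is needed because \<open>x0\<close> may lie on the boundary of the orthant, and then the multiples
  of \<open>x0\<close> do not dominate all points.\<close>

lemma usc_shift_to_interior:
  fixes F :: "real^'n \<Rightarrow> (real^'m) set"
  assumes usc: "usc_map F" and x0: "x0 \<in> orthant"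
    and V: "openin (top_of_set orthant) V" "F x0 \<subseteq> V"
  obtains z where "\<And>i. 0 < z $ i" "x0 \<le> z" "F z \<subseteq> V"
proof -
  obtain U where U: "openin (top_of_set orthant) U" "x0 \<in> U" "\<And>x. x \<in> U \<Longrightarrow> F x \<subseteq> V"
    using usc[unfolded usc_map_def, rule_format, OF x0 conjI[OF V]] by blast
  then obtain W where W: "open W" "U = orthant \<inter> W"
    by (auto simp: openin_open)
  have "((\<lambda>e. x0 + e *\<^sub>R (\<chi> i. 1)) \<longlongrightarrow> x0 + 0 *\<^sub>R (\<chi> i. 1)) (at_right (0::real))"
    by (intro tendsto_intros)
  then have "\<forall>\<^sub>F e in at_right (0::real). x0 + e *\<^sub>R (\<chi> i. 1) \<in> W"
    using W U(2) by (intro topological_tendstoD) auto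
  moreover have "\<forall>\<^sub>F e in at_right (0::real). 0 < e"
    by (simp add: eventually_at_right_less)
  ultimately have "\<forall>\<^sub>F e in at_right (0::real). 0 < e \<and> x0 + e *\<^sub>R (\<chi> i. 1) \<in> W"
    by eventually_elim simp
  then obtain e :: real where e: "0 < e" "x0 + e *\<^sub>R (\<chi> i. 1) \<in> W"
    using eventually_happens'[OF trivial_limit_at_right_real] by blast
  have pos: "0 < (x0 + e *\<^sub>R (\<chi> i. 1)) $ i" for i
    using e(1) x0 by (simp add: mem_orthant_iff add_nonneg_pos)
  then have "x0 + e *\<^sub>R (\<chi> i. 1) \<in> U"
    using e(2) unfolding W(2) by (auto simp: mem_orthant_iff less_imp_le)
  with pos U(3) e(1) show thesis
    by (intro that[of "x0 + e *\<^sub>R (\<chi> i. 1)"]) (auto simp: less_eq_vec_def)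
qed

text \<open>The vector \<open>l\<close> is chosen with \<open>l $ i * (s * y0 $ i) = c\<close> on the support of \<open>y0\<close>. Then
  \<open>min_pairing l y \<le> c\<close> holds for every \<open>y\<close> in the orthant that is not above \<open>s *\<^sub>R y0\<close>, while
  \<open>min_pairing l y0 = c / s > c\<close>.\<close>

lemma separation:
  fixes F :: "real^'n \<Rightarrow> (real^'m) set"
  assumes sv: "setvalued_map F" and icr: "ICR F" and usc: "usc_map F"
    and val: "\<And>x. x \<in> orthant \<Longrightarrow> F x \<noteq> {} \<and> compact (F x) \<and> normal_set (F x)"
    and x0: "x0 \<in> orthant" and y0: "y0 \<in> orthant" "y0 \<notin> F x0"
  obtains l k c where "l \<in> orthant - {0}" "k \<in> orthant" "0 \<le> c"
    "\<And>x. x \<in> orthant \<Longrightarrow> F x \<subseteq> Delta l k c x" "y0 \<notin> Delta l k c x0"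
proof -
  obtain s :: real where s: "0 < s" "s < 1" "s *\<^sub>R y0 \<notin> F x0"
  proof -
    have "open (- F x0)"
      using val[OF x0] by (simp add: compact_imp_closed open_Compl)
    moreover have "((\<lambda>s. s *\<^sub>R y0) \<longlongrightarrow> 1 *\<^sub>R y0) (at_left (1::real))"
      by (intro tendsto_intros)
    ultimately have "\<forall>\<^sub>F s in at_left (1::real). s *\<^sub>R y0 \<in> - F x0"
      using y0(2) by (intro topological_tendstoD) auto
    moreover have "\<forall>\<^sub>F s in at_left (1::real). s \<in> {0<..<1}"
      by (rule eventually_at_leftI[of 0]) auto
    ultimately have "\<forall>\<^sub>F s in at_left (1::real). s *\<^sub>R y0 \<in> - F x0 \<and> s \<in> {0<..<1}"
      by eventually_elim simp
    then obtain s :: real where "s *\<^sub>R y0 \<in> - F x0 \<and> s \<in> {0<..<1}"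
      using eventually_happens'[OF trivial_limit_at_left_real] by blast
    then show thesis
      using that by auto
  qed
  have y0_nonneg: "0 \<le> y0 $ i" for i
    using y0(1) by (simp add: mem_orthant_iff)
  define V where "V = orthant \<inter> (\<Union>i. {y. y $ i < s * y0 $ i})"
  have "openin (top_of_set orthant) V"
    unfolding V_def by (intro openin_open_Int open_UN open_Collect_less continuous_intros ballI)
  moreover have "F x0 \<subseteq> V"
  proof
    fix y
    assume y: "y \<in> F x0"
    then have "\<not> s *\<^sub>R y0 \<le> y"
      using val[OF x0] s y0_nonneg unfolding normal_set_def
      by (auto simp: less_eq_vec_def)
    then show "y \<in> V"
      using y sv x0 by (auto simp: V_def less_eq_vec_def setvalued_map_def not_le)
  qed
  ultimately obtain z where z: "\<And>i. 0 < z $ i" "x0 \<le> z" "F z \<subseteq> V"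
    using usc_shift_to_interior[OF usc x0] by blast
  then have "z \<in> orthant"
    by (simp add: mem_orthant_iff less_imp_le)
  then obtain c where c: "0 < c" "\<And>y. y \<in> F z \<Longrightarrow> norm y \<le> c"
    using val compact_imp_bounded bounded_pos by metis
  define l :: "real^'m" where "l = (\<chi> i. if 0 < y0 $ i then c / (s * y0 $ i) else 0)"
  have "0 \<in> F x0"
    using val[OF x0] sv x0 unfolding normal_set_def setvalued_map_def orthant_def by blast
  then obtain i where "0 < y0 $ i"
    using y0(2) y0_nonneg by (metis order_less_le vec_eq_iff zero_index)
  then have "0 < l $ i"
    using c s by (simp add: l_def)
  moreover have "l \<in> orthant"
    using c s by (auto simp: l_def mem_orthant_iff)
  ultimately have l: "l \<in> orthant - {0}"
    by auto
  let ?k = "\<chi> i. c / z $ i"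
  show thesis
  proof
    show "l \<in> orthant - {0}" "0 \<le> c"
      using l c by auto
    show "?k \<in> orthant"
      using c z by (simp add: mem_orthant_iff less_imp_le)
    have "F z \<subseteq> Delta l ?k c z"
    proof
      fix y
      assume y: "y \<in> F z"
      with z(3) obtain j where j: "y \<in> orthant" "y $ j < s * y0 $ j"
        by (auto simp: V_def)
      have "0 \<le> y $ j"
        using j(1) by (simp add: mem_orthant_iff)
      with j s have "0 < y0 $ j"
        by (meson le_less_trans zero_less_mult_pos)
      with j s c have "0 < l $ j" "l $ j * y $ j \<le> c"
        by (auto simp: l_def field_simps)
      moreover have "y $ i \<le> c" for i
        using c(2)[OF y] component_le_norm_cart[of y i] by linarith
      ultimately show "y \<in> Delta l ?k c z"
        using j(1) by (auto simp: mem_Delta_iff[OF l] h_plus_reciprocal_eq[OF c(1) z(1)])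
    qed
    then show "F x \<subseteq> Delta l ?k c x" if "x \<in> orthant" for x
      using subset_Delta_if_subset_at_point[OF sv icr c(1) z(1) l _ that] by blast
    have "c < l $ j * y0 $ j" if "0 < l $ j" for j
      using that c s by (auto simp: l_def field_simps split: if_splits)
    then show "y0 \<notin> Delta l ?k c x0"
      by (auto simp: mem_Delta_iff[OF l] h_plus_reciprocal_eq[OF c(1) z(1,2)] not_le)
  qed
qed

section \<open>The characterization\<close>

theorem theorem38:
  fixes F :: "real^'n \<Rightarrow> (real^'m) set"
  assumes "setvalued_map F"
  shows "(ICR F \<and> usc_map F \<and>
          (\<forall>x\<in>orthant. F x \<noteq> {} \<and> compact (F x) \<and> normal_set (F x)))
     \<longleftrightarrow>
     (\<exists>T :: ((real^'m) \<times> (real^'n) \<times> real) set.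
        T \<noteq> {} \<and> T \<subseteq> (orthant - {0}) \<times> orthant \<times> {0..} \<and>
        (\<forall>x\<in>orthant. F x = (\<Inter>(l, k, c)\<in>T. Delta l k c x)))"
    (is "?P \<longleftrightarrow> ?Q")
proof
  assume ?P
  then have icr: "ICR F" and usc: "usc_map F"
    and val: "\<And>x. x \<in> orthant \<Longrightarrow> F x \<noteq> {} \<and> compact (F x) \<and> normal_set (F x)"
    by auto
  define T where "T = {(l, k, c). l \<in> orthant - {0} \<and> k \<in> orthant \<and> 0 \<le> c \<and>
    (\<forall>x\<in>orthant. F x \<subseteq> Delta l k c x)}"
  have sep: "\<exists>(l, k, c)\<in>T. y \<notin> Delta l k c x"
    if "x \<in> orthant" "y \<in> orthant" "y \<notin> F x" for x y
    using separation[OF assms icr usc val that] unfolding T_def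
    by (smt (verit) case_prodI mem_Collect_eq)
  have "T \<noteq> {}"
  proof -
    \<comment> \<open>A separable point exists because \<open>F 0\<close> is bounded and the orthant is not.\<close>
    have "0 \<in> (orthant :: (real^'n) set)"
      by (simp add: mem_orthant_iff)
    moreover from this obtain b where b: "0 < b" "\<And>y. y \<in> F 0 \<Longrightarrow> norm y \<le> b"
      using val compact_imp_bounded bounded_pos by metis
    define y :: "real^'m" where "y = (\<chi> i. b + 1)"
    have "b < norm y"
      using component_le_norm_cart[of y undefined] b by (simp add: y_def)
    then have "y \<notin> F 0"
      using b(2) by fastforce
    moreover have "y \<in> orthant"
      using b by (simp add: y_def mem_orthant_iff)
    ultimately show ?thesis
      using sep by blast
  qed
  moreover have "T \<subseteq> (orthant - {0}) \<times> orthant \<times> {0..}"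
    by (auto simp: T_def)
  moreover have "F x = (\<Inter>(l, k, c)\<in>T. Delta l k c x)" if "x \<in> orthant" for x
  proof
    show "F x \<subseteq> (\<Inter>(l, k, c)\<in>T. Delta l k c x)"
      using that by (auto simp: T_def)
    show "(\<Inter>(l, k, c)\<in>T. Delta l k c x) \<subseteq> F x"
    proof
      fix y
      assume y: "y \<in> (\<Inter>(l, k, c)\<in>T. Delta l k c x)"
      with \<open>T \<noteq> {}\<close> have "y \<in> orthant"
        by (auto simp: Delta_def)
      with y sep[OF that] show "y \<in> F x"
        by fast
    qed
  qed
  ultimately show ?Q
    by (intro exI[of _ T] conjI ballI)
next
  assume ?Q
  then obtain T :: "((real^'m) \<times> (real^'n) \<times> real) set" where
    T: "T \<noteq> {}" "T \<subseteq> (orthant - {0}) \<times> orthant \<times> {0..}"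
    and F: "\<forall>x\<in>orthant. F x = (\<Inter>(l, k, c)\<in>T. Delta l k c x)"
    by (elim exE conjE)
  show ?P
    by (rule Inter_Delta_properties[OF assms T F[rule_format]])
qed

end
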